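(* Let $r\in\mathbb N$, let $G$ be a graph and $k=\mathrm{mw}_{18r+1}(G)$. Then $G$ is $(13,12)$-quasi-isometric to some graph $H$ with $\mathrm{scol}_r(H)\le k\cdot\pi_G(k)$.
   Context: Graphs are finite, simple, undirected. $\pi_G(m)=\max_{A\subseteq V(G),|A|\le m}|\{N(v)\cap A:v\in V(G)\}|$. For a partition $\mathcal P$ of $V(G)$ and $X\subseteq V(G)$, $X/\mathcal P$ is the set of parts intersecting $X$. For $R\subseteq\binom{V(G)}2$, $\mathrm{Ball}^r_R(v)$ is the radius-$r$ ball in $(V(G),R)$. $\mathcal P$ is homogeneous modulo $R$ if for all parts $X,Y$ (possibly equal), the pairs $\{x,y\}$, $x\in X,y\in Y,x\ne y$, not in $R$ are all edges of $G$ or all non-edges. A merge sequence for $G$ is $(\mathcal P_1,R_1),\dots,(\mathcal P_m,R_m)$ with $\mathcal P_1\preceq\dots\preceq\mathcal P_m$ partitions of $V(G)$, $\mathcal P_1$ into singletons, $\mathcal P_m=\{V(G)\}$, $R_1\subseteq\dots\subseteq R_m$, $\mathcal P_t$ homogeneous modulo $R_t$; its radius-$r$ width is $\max_{t<m}\max_v|\mathrm{Ball}^r_{R_{t+1}}(v)/\mathcal P_t|$; $\mathrm{mw}_r(G)$ is the minimum. For a graph $H$ and total order $<$ on $V(H)$, $u$ is strongly $r$-reachable from $v\ge u$ if there is a path of length at most $r$ from $v$ to $u$ whose internal vertices $w$ satisfy $w>v$; $\mathrm{scol}_r(H)$ is the minimum over orders of the maximum over $v$ of the number of vertices strongly $r$-reachable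 from $v$. A map $\phi:V(G)\to V(H)$ is an $(a,b)$-quasi-isometry if $\frac1a\mathrm{dist}_G(x,x')-b\le\mathrm{dist}_H(\phi(x),\phi(x'))\le a\,\mathrm{dist}_G(x,x')+b$ for all $x,x'\in V(G)$ and for every $y\in V(H)$ some $x$ has $\mathrm{dist}_H(y,\phi(x))\le b$; $G$ is $(a,b)$-quasi-isometric to $H$ if such a map exists. *)

theory Defs
  imports Complex_Main "HOL-Library.Disjoint_Sets" "HOL-Library.Extended_Real"
begin

definition pairs :: "'a set \<Rightarrow> 'a set set" where
  "pairs V = {{x, y} | x y. x \<in> V \<and> y \<in> V \<and> x \<noteq> y}"

definition fin_graph :: "'a set \<Rightarrow> 'a set set \<Rightarrow> bool" where
  "fin_graph V E \<longleftrightarrow> finite V \<and> E \<subseteq> pairs V"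

definition nbh :: "'a set \<Rightarrow> 'a set set \<Rightarrow> 'a \<Rightarrow> 'a set" where
  "nbh V E v = {u \<in> V. {v, u} \<in> E}"

definition is_path :: "'a set \<Rightarrow> 'a set set \<Rightarrow> 'a list \<Rightarrow> 'a \<Rightarrow> 'a \<Rightarrow> bool" where
  "is_path V E xs u v \<longleftrightarrow>
     xs \<noteq> [] \<and> set xs \<subseteq> V \<and> distinct xs \<and> successively (\<lambda>x y. {x, y} \<in> E) xs \<and>
     hd xs = u \<and> last xs = v"

definition path_length :: "'a list \<Rightarrow> nat" where
  "path_length xs = length xs - 1"

text \<open>The infimum of the empty set is \<open>\<infinity>\<close>, the distance between different components.\<close>
definition gdist :: "'a set \<Rightarrow> 'a set set \<Rightarrow> 'a \<Rightarrow> 'a \<Rightarrow> enat" where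
  "gdist V E u v = (INF xs \<in> {xs. is_path V E xs u v}. enat (path_length xs))"

definition gball :: "'a set \<Rightarrow> 'a set set \<Rightarrow> nat \<Rightarrow> 'a \<Rightarrow> 'a set" where
  "gball V R r v = {u \<in> V. gdist V R v u \<le> enat r}"

definition nbh_complexity :: "'a set \<Rightarrow> 'a set set \<Rightarrow> nat \<Rightarrow> nat" where
  "nbh_complexity V E m =
     Max {card ((\<lambda>v. nbh V E v \<inter> A) ` V) | A. A \<subseteq> V \<and> card A \<le> m}"

definition parts_meeting :: "'a set \<Rightarrow> 'a set set \<Rightarrow> 'a set set" where
  "parts_meeting X P = {Y \<in> P. Y \<inter> X \<noteq> {}}"

definition homogeneous_mod :: "'a set set \<Rightarrow> 'a set set \<Rightarrow> 'a set set \<Rightarrow> bool" where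
  "homogeneous_mod E P R \<longleftrightarrow>
     (\<forall>X\<in>P. \<forall>Y\<in>P.
        (\<forall>x\<in>X. \<forall>y\<in>Y. x \<noteq> y \<and> {x, y} \<notin> R \<longrightarrow> {x, y} \<in> E) \<or>
        (\<forall>x\<in>X. \<forall>y\<in>Y. x \<noteq> y \<and> {x, y} \<notin> R \<longrightarrow> {x, y} \<notin> E))"

text \<open>Only the values of \<open>P\<close> and \<open>R\<close> at the indices \<open>1, \<dots>, m\<close> matter.\<close>
definition merge_sequence ::
    "'a set \<Rightarrow> 'a set set \<Rightarrow> nat \<Rightarrow> (nat \<Rightarrow> 'a set set) \<Rightarrow> (nat \<Rightarrow> 'a set set) \<Rightarrow> bool" where
  "merge_sequence V E m P R \<longleftrightarrow>
     1 \<le> m \<and>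
     (\<forall>t\<in>{1..m}. partition_on V (P t) \<and> R t \<subseteq> pairs V \<and> homogeneous_mod E (P t) (R t)) \<and>
     (\<forall>t\<in>{1..<m}. refines V (P t) (P (Suc t)) \<and> R t \<subseteq> R (Suc t)) \<and>
     P 1 = (\<lambda>v. {v}) ` V \<and> P m = {V}"

text \<open>On finite sets of natural numbers the supremum is the maximum, and it is \<open>0\<close> on
  the empty set.\<close>
definition seq_width ::
    "'a set \<Rightarrow> nat \<Rightarrow> nat \<Rightarrow> (nat \<Rightarrow> 'a set set) \<Rightarrow> (nat \<Rightarrow> 'a set set) \<Rightarrow> nat" where
  "seq_width V r m P R =
     (SUP t\<in>{1..<m}. SUP v\<in>V. card (parts_meeting (gball V (R (Suc t)) r v) (P t)))"

text \<open>The width is a maximum over \<open>t < m\<close>, which only makes sense for \<open>m \<ge> 2\<close>. This is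
  automatic if there are at least two vertices; for a single vertex, it rules out the
  sequence with \<open>m = 1\<close>, so that the merge-width is \<open>1\<close> and not the maximum of the
  empty set.\<close>
definition merge_width :: "nat \<Rightarrow> 'a set \<Rightarrow> 'a set set \<Rightarrow> nat" where
  "merge_width r V E =
     (LEAST w. \<exists>m P R. 2 \<le> m \<and> merge_sequence V E m P R \<and> w = seq_width V r m P R)"

text \<open>The relation \<open>L\<close> is the reflexive order: \<open>(x, y) \<in> L\<close> means \<open>x \<le> y\<close>.\<close>
definition strongly_reachable ::
    "'a set \<Rightarrow> 'a set set \<Rightarrow> 'a rel \<Rightarrow> nat \<Rightarrow> 'a \<Rightarrow> 'a \<Rightarrow> bool" where
  "strongly_reachable V E L r v u \<longleftrightarrow>
     (u, v) \<in> L \<and>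
     (\<exists>xs. is_path V E xs v u \<and> path_length xs \<le> r \<and>
        (\<forall>w \<in> set (butlast (tl xs)). (v, w) \<in> L \<and> w \<noteq> v))"

definition scol :: "nat \<Rightarrow> 'a set \<Rightarrow> 'a set set \<Rightarrow> nat" where
  "scol r V E =
     (LEAST c. \<exists>L. linear_order_on V L \<and>
        c = (SUP v\<in>V. card {u \<in> V. strongly_reachable V E L r v u}))"

definition quasi_isometry ::
    "real \<Rightarrow> real \<Rightarrow> 'a set \<Rightarrow> 'a set set \<Rightarrow> 'b set \<Rightarrow> 'b set set \<Rightarrow> ('a \<Rightarrow> 'b) \<Rightarrow> bool" where
  "quasi_isometry a b V E W F \<phi> \<longleftrightarrow>
     \<phi> ` V \<subseteq> W \<and>
     (\<forall>x\<in>V. \<forall>x'\<in>V.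
        ereal (1 / a) * ereal_of_enat (gdist V E x x') - ereal b
          \<le> ereal_of_enat (gdist W F (\<phi> x) (\<phi> x')) \<and>
        ereal_of_enat (gdist W F (\<phi> x) (\<phi> x'))
          \<le> ereal a * ereal_of_enat (gdist V E x x') + ereal b) \<and>
     (\<forall>y\<in>W. \<exists>x\<in>V. ereal_of_enat (gdist W F y (\<phi> x)) \<le> ereal b)"

definition quasi_isometric ::
    "real \<Rightarrow> real \<Rightarrow> 'a set \<Rightarrow> 'a set set \<Rightarrow> 'b set \<Rightarrow> 'b set set \<Rightarrow> bool" where
  "quasi_isometric a b V E W F \<longleftrightarrow> (\<exists>\<phi>. quasi_isometry a b V E W F \<phi>)"

end

theory Submission
  imports Defs
begin

text \<open>Call a vertex active at time \<open>t\<close> if it has an edge whose ends are at distance more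
  than 3 in \<open>R\<^sub>t\<close>, and let its level be the time at which it stops being active. Choose
  greedily, by decreasing level, a set \<open>S\<close> of vertices at pairwise distance more than 2, and
  map every vertex \<open>z\<close> to the first \<open>c(z) \<in> S\<close> at distance at most 2. The graph \<open>H\<close> on
  \<open>S\<close>, in which \<open>c(z)\<close> and \<open>c(z')\<close> are adjacent for every edge \<open>zz'\<close>, is quasi-isometric
  to \<open>G\<close>, and it is ordered by decreasing level.

  Suppose that \<open>u\<close> is strongly \<open>r\<close>-reachable from \<open>v\<close> and \<open>v\<close> has level \<open>t + 1\<close>. All
  vertices mapped to inner vertices of the path are inactive at time \<open>t + 1\<close>, so the path
  is traced by a walk in \<open>R\<^bsub>t+1\<^esub>\<close> from \<open>v\<close> to some \<open>z\<close> with \<open>c(z) = u\<close>, and this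
  \<open>z\<close> lies in one of \<open>k\<close> parts of \<open>P\<^sub>t\<close>. Within one part, distinct \<open>u\<close> give vertices
  \<open>z\<close> with distinct neighbourhoods on a set of vertices from distinct parts of \<open>P\<^sub>t\<close> that
  meet the ball, so there are at most \<open>\<pi>\<^sub>G(k)\<close> of them.\<close>

section \<open>Bounded walks\<close>

text \<open>Walks rather than paths, so that concatenation is plain composition. Adjoining
  \<open>Id\<close> turns length exactly \<open>n\<close> into length at most
  \<open>n\<close>.\<close>

definition near :: "'a set set \<Rightarrow> nat \<Rightarrow> ('a \<times> 'a) set" where
  "near R n = (Id \<union> {(x, y). {x, y} \<in> R}) ^^ n"

lemma near_0 [simp]: "near R 0 = Id"
  by (simp add: near_def)

lemma near_Suc: "near R (Suc n) = near R n O (Id \<union> {(x, y). {x, y} \<in> R})"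
  by (simp add: near_def)

lemma near_trans:
  assumes "(x, y) \<in> near R m" "(y, z) \<in> near R n"
  shows "(x, z) \<in> near R (m + n)"
  using assms unfolding near_def relpow_add by blast

lemma near_refl [simp]: "(x, x) \<in> near R n"
  by (induction n) (auto simp: near_Suc)

lemma near_le:
  assumes "(x, y) \<in> near R m" "m \<le> n"
  shows "(x, y) \<in> near R n"
  using near_trans[OF assms(1) near_refl, of "n - m"] assms(2) by simp

lemma near_edge: "{x, y} \<in> R \<Longrightarrow> (x, y) \<in> near R (Suc 0)"
  by (auto simp: near_Suc)

lemma near_edge_le: "{x, y} \<in> R \<Longrightarrow> 0 < d \<Longrightarrow> (x, y) \<in> near R d"
  using near_le[OF near_edge, of x y R d] by simp

lemma near_sym:
  assumes "(x, y) \<in> near R n"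
  shows "(y, x) \<in> near R n"
  using assms
proof (induction n arbitrary: y)
  case (Suc n)
  then obtain w where w: "(x, w) \<in> near R n" "w = y \<or> {w, y} \<in> R"
    by (auto simp: near_Suc)
  have "(y, w) \<in> near R (Suc 0)"
    using w(2) near_edge[of y w R] by (auto simp: insert_commute)
  from near_trans[OF this Suc.IH[OF w(1)]] show ?case
    by simp
qed simp

lemma near_mono:
  assumes "R \<subseteq> R'"
  shows "near R n \<subseteq> near R' n"
proof (induction n)
  case (Suc n)
  then show ?case
    using assms unfolding near_Suc by blast
qed simp

text \<open>Each edge of the walk is replaced by a walk of length at most \<open>d\<close>; this
  carries distances to the quotient graph and back.\<close>

lemma near_map:
  assumes "(x, y) \<in> near R n"
    and "\<And>x y. {x, y} \<in> R \<Longrightarrow> (f x, f y) \<in> near R' d"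
  shows "(f x, f y) \<in> near R' (d * n)"
  using assms(1)
proof (induction n arbitrary: y)
  case (Suc n)
  then obtain w where w: "(x, w) \<in> near R n" "w = y \<or> {w, y} \<in> R"
    by (auto simp: near_Suc)
  have "(f w, f y) \<in> near R' d"
    using w(2) assms(2) by auto
  from near_trans[OF Suc.IH[OF w(1)] this] show ?case
    by (simp add: add.commute)
qed simp

lemma near_2E:
  assumes "(x, z) \<in> near R 2"
  obtains y where "x = y \<or> {x, y} \<in> R" "y = z \<or> {y, z} \<in> R"
  using assms by (auto simp: near_Suc numeral_2_eq_2)

lemma near_2I: "{x, y} \<in> R \<Longrightarrow> y = z \<or> {y, z} \<in> R \<Longrightarrow> (x, z) \<in> near R 2"
  by (auto simp: near_Suc numeral_2_eq_2)

lemma pairs_doubleton: "{x, y} \<in> pairs V \<longleftrightarrow> x \<in> V \<and> y \<in> V \<and> x \<noteq> y"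
  by (auto simp: pairs_def doubleton_eq_iff)

lemma path_imp_near:
  assumes "xs \<noteq> []" "successively (\<lambda>x y. {x, y} \<in> R) xs"
  shows "(hd xs, last xs) \<in> near R (length xs - 1)"
  using assms
proof (induction xs rule: rev_nonempty_induct)
  case (snoc x xs)
  then have "(hd xs, last xs) \<in> near R (length xs - 1)" "{last xs, x} \<in> R"
    by (auto simp: successively_append_iff)
  from near_trans[OF this(1) near_edge[OF this(2)]] show ?case
    using snoc.hyps by simp
qed simp

lemma near_imp_path:
  assumes "R \<subseteq> pairs V" "x \<in> V" "(x, y) \<in> near R n"
  shows "\<exists>xs. is_path V R xs x y \<and> path_length xs \<le> n"
  using assms(3)
proof (induction n arbitrary: y)
  case 0
  then have "is_path V R [x] x y"
    using assms(2) by (simp add: is_path_def)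
  then show ?case
    by (intro exI[of _ "[x]"]) (simp add: path_length_def)
next
  case (Suc n)
  then obtain w where w: "(x, w) \<in> near R n" "w = y \<or> {w, y} \<in> R"
    by (auto simp: near_Suc)
  from Suc.IH[OF w(1)] obtain xs where xs: "is_path V R xs x w" "path_length xs \<le> n"
    by blast
  show ?case
  proof (cases "y \<in> set xs")
    \<comment> \<open>A walk that returns to its path is cut to the prefix ending at
      \<open>y\<close>, which keeps the vertices distinct.\<close>
    case True
    then obtain as bs where ab: "xs = as @ y # bs"
      by (auto simp: in_set_conv_decomp)
    then have "is_path V R (as @ [y]) x y"
      using xs(1) successively_append_iff[of _ "as @ [y]" bs]
      by (cases as) (auto simp: is_path_def)
    moreover have "path_length (as @ [y]) \<le> Suc n"
      using xs(2) ab by (simp add: path_length_def)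
    ultimately show ?thesis
      by blast
  next
    case False
    then have "w \<noteq> y"
      using xs(1) by (auto simp: is_path_def)
    then have "{w, y} \<in> R"
      using w(2) by blast
    then have "is_path V R (xs @ [y]) x y"
      using xs(1) False assms(1)
      by (auto simp: is_path_def successively_append_iff pairs_doubleton dest: subsetD)
    moreover have "path_length (xs @ [y]) \<le> Suc n"
      using xs(2) by (simp add: path_length_def)
    ultimately show ?thesis
      by blast
  qed
qed

lemma gdist_le_iff_near:
  assumes "R \<subseteq> pairs V" "x \<in> V"
  shows "gdist V R x y \<le> enat n \<longleftrightarrow> (x, y) \<in> near R n"
proof
  assume le: "gdist V R x y \<le> enat n"
  let ?A = "(\<lambda>xs. enat (path_length xs)) ` {xs. is_path V R xs x y}"
  have ne: "?A \<noteq> {}"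
  proof
    assume "?A = {}"
    then have "gdist V R x y = \<infinity>"
      unfolding gdist_def by (simp only: Inf_empty top_enat_def)
    then show False
      using le by simp
  qed
  \<comment> \<open>A nonempty set in \<open>enat\<close> contains its infimum, so a shortest path
    exists.\<close>
  then have "Inf ?A \<in> ?A"
    by (metis Inf_enat_def LeastI ex_in_conv)
  then obtain xs where xs: "is_path V R xs x y" "enat (path_length xs) \<le> enat n"
    using le unfolding gdist_def by auto
  then have "(x, y) \<in> near R (length xs - 1)"
    using path_imp_near[of xs R] by (auto simp: is_path_def)
  then show "(x, y) \<in> near R n"
    by (rule near_le) (use xs(2) in \<open>simp add: path_length_def\<close>)
next
  assume "(x, y) \<in> near R n"
  from near_imp_path[OF assms this] obtain xs
    where "is_path V R xs x y" "path_length xs \<le> n" by blast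
  then show "gdist V R x y \<le> enat n"
    unfolding gdist_def by (intro INF_lower2[of xs]) auto
qed

lemma near_carrier:
  assumes "R \<subseteq> pairs V" "x \<in> V" "(x, y) \<in> near R n"
  shows "y \<in> V"
  using near_imp_path[OF assms] by (auto simp: is_path_def)

lemma mem_gball_iff:
  assumes "R \<subseteq> pairs V" "v \<in> V"
  shows "u \<in> gball V R n v \<longleftrightarrow> (v, u) \<in> near R n"
  using gdist_le_iff_near[OF assms] near_carrier[OF assms] by (auto simp: gball_def)

lemma card_nbh_traces_le:
  assumes "finite V" "A \<subseteq> V" "card A \<le> k"
  shows "card ((\<lambda>v. nbh V E v \<inter> A) ` V) \<le> nbh_complexity V E k"
proof -
  have "{card ((\<lambda>v. nbh V E v \<inter> A) ` V) | A. A \<subseteq> V \<and> card A \<le> k}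
      \<subseteq> (\<lambda>A. card ((\<lambda>v. nbh V E v \<inter> A) ` V)) ` Pow V"
    by auto
  then have "finite {card ((\<lambda>v. nbh V E v \<inter> A) ` V) | A. A \<subseteq> V \<and> card A \<le> k}"
    by (rule finite_subset) (simp add: assms(1))
  then show ?thesis
    unfolding nbh_complexity_def using assms by (intro Max_ge) auto
qed

section \<open>Activity levels\<close>

text \<open>With \<open>R 0 = {}\<close> only isolated vertices have level 0, and
  \<open>E \<subseteq> R n\<close> makes every vertex inactive in the end. \<open>P\<close> stops
  before \<open>n\<close> because the width pairs \<open>P t\<close> with
  \<open>R (Suc t)\<close>.\<close>

locale tower =
  fixes V :: "'a set" and E :: "'a set set"
    and P R :: "nat \<Rightarrow> 'a set set" and n :: nat
  assumes finite_V: "finite V"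
    and E_pairs: "E \<subseteq> pairs V"
    and R_pairs: "\<And>t. t \<le> n \<Longrightarrow> R t \<subseteq> pairs V"
    and partition: "\<And>t. t < n \<Longrightarrow> partition_on V (P t)"
    and homogeneous: "\<And>t. t < n \<Longrightarrow> homogeneous_mod E (P t) (R t)"
    and R_step: "\<And>t. t < n \<Longrightarrow> R t \<subseteq> R (Suc t)"
    and R_start: "R 0 = {}"
    and R_end: "E \<subseteq> R n"
begin

lemma R_mono: "s \<le> t \<Longrightarrow> t \<le> n \<Longrightarrow> R s \<subseteq> R t"
proof (induction t rule: dec_induct)
  case (step t)
  then show ?case
    using R_step[of t] by auto
qed simp

text \<open>The radius 3 is what makes an active edge \<open>xy\<close> contradict a walk
  \<open>x, y', x', y\<close> in \<open>R t\<close>; such walks arise from three vertices of one part that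
  are far apart in the graph.\<close>
definition active :: "nat \<Rightarrow> 'a \<Rightarrow> bool" where
  "active t x \<longleftrightarrow> (\<exists>y. {x, y} \<in> E \<and> (x, y) \<notin> near (R t) 3)"

definition level :: "'a \<Rightarrow> nat" where
  "level x = (LEAST t. \<not> active t x)"

lemma not_active_end: "\<not> active n x"
proof -
  have "(x, y) \<in> near (R n) 3" if "{x, y} \<in> E" for y
    using near_edge_le[of x y "R n" 3] that R_end by auto
  then show ?thesis
    by (auto simp: active_def)
qed

lemma level_le: "level x \<le> n"
  unfolding level_def by (rule Least_le) (rule not_active_end)

lemma active_below_level: "t < level x \<Longrightarrow> active t x"
  unfolding level_def using not_less_Least by blast

text \<open>\<open>R\<close> only grows, so a vertex that is once inactive stays so.\<close>

lemma near_above_level: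
  assumes "level x \<le> t" "t \<le> n" "{x, y} \<in> E"
  shows "(x, y) \<in> near (R t) 3"
proof -
  have "\<not> active (level x) x"
    unfolding level_def by (rule LeastI) (rule not_active_end)
  then have "(x, y) \<in> near (R (level x)) 3"
    using assms(3) by (auto simp: active_def)
  then show ?thesis
    using near_mono[OF R_mono[OF assms(1,2)]] by blast
qed

text \<open>The middle vertex may still be active, so each of the two edges is replaced from its
  outer end, at cost 3.\<close>

lemma near2_above_level:
  assumes "level x \<le> t" "level y \<le> t" "t \<le> n" "(x, y) \<in> near E 2"
  shows "(x, y) \<in> near (R t) 6"
proof -
  obtain w where w: "x = w \<or> {x, w} \<in> E" "w = y \<or> {w, y} \<in> E"
    using assms(4) by (rule near_2E)
  have "(x, w) \<in> near (R t) 3"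
    using w(1) near_above_level[OF assms(1,3)] by auto
  moreover have "(w, y) \<in> near (R t) 3"
    using w(2) near_above_level[OF assms(2,3), of w] near_sym[of y w]
    by (auto simp: insert_commute)
  ultimately show ?thesis
    using near_trans[of x w "R t" 3 y 3] by simp
qed

lemma E_carrier: "{x, y} \<in> E \<Longrightarrow> x \<in> V \<and> y \<in> V \<and> x \<noteq> y"
  using subsetD[OF E_pairs, of "{x, y}"] by (simp add: pairs_doubleton)

text \<open>The form in which homogeneity is used: one edge outside \<open>R t\<close> forces all
  pairs outside \<open>R t\<close> between the two parts to be edges.\<close>

lemma in_R_if_full:
  assumes "t < n" "X \<in> P t" "Y \<in> P t" "x0 \<in> X" "y0 \<in> Y" "{x0, y0} \<in> E" "{x0, y0} \<notin> R t"
    and "x \<in> X" "y \<in> Y" "x \<noteq> y" "{x, y} \<notin> E"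
  shows "{x, y} \<in> R t"
proof -
  have "x0 \<noteq> y0"
    using E_carrier[OF assms(6)] by blast
  then show ?thesis
    using homogeneous[OF assms(1)] assms(2-) unfolding homogeneous_mod_def by blast
qed

end

text \<open>Vertices are treated in the order of \<open>num\<close> and chosen unless an earlier
  choice lies within distance 2, so whatever blocks \<open>z\<close> has a smaller number.\<close>

lemma exists_greedy_net:
  fixes num :: "'a \<Rightarrow> nat"
  assumes "inj_on num V"
  shows "\<exists>S \<subseteq> {x \<in> V. num x < b}.
           (\<forall>s\<in>S. \<forall>s'\<in>S. (s, s') \<in> near E 2 \<longrightarrow> s = s') \<and>
           (\<forall>z\<in>V. num z < b \<longrightarrow> (\<exists>s\<in>S. (s, z) \<in> near E 2 \<and> num s \<le> num z))"
proof (induction b)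
  case (Suc b)
  then obtain S where S: "S \<subseteq> {x \<in> V. num x < b}"
    "\<forall>s\<in>S. \<forall>s'\<in>S. (s, s') \<in> near E 2 \<longrightarrow> s = s'"
    "\<forall>z\<in>V. num z < b \<longrightarrow> (\<exists>s\<in>S. (s, z) \<in> near E 2 \<and> num s \<le> num z)"
    by blast
  show ?case
  proof (cases "\<exists>x\<in>V. num x = b \<and> (\<forall>s\<in>S. (s, x) \<notin> near E 2)")
    case True
    then obtain x where x: "x \<in> V" "num x = b" "\<forall>s\<in>S. (s, x) \<notin> near E 2"
      by blast
    have uniq: "z = x" if "z \<in> V" "num z = b" for z
      using that x(1,2) assms by (auto dest: inj_onD)
    have "\<forall>s\<in>insert x S. \<forall>s'\<in>insert x S. (s, s') \<in> near E 2 \<longrightarrow> s = s'"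
      using S(2) x(3) near_sym[of _ _ E 2] by blast
    moreover have "\<exists>s\<in>insert x S. (s, z) \<in> near E 2 \<and> num s \<le> num z"
      if "z \<in> V" "num z < Suc b" for z
      using S(3) that uniq[of z] by (cases "num z = b") auto
    moreover have "insert x S \<subseteq> {x \<in> V. num x < Suc b}"
      using S(1) x(1,2) by auto
    ultimately show ?thesis
      by blast
  next
    case False
    have "\<exists>s\<in>S. (s, z) \<in> near E 2 \<and> num s \<le> num z" if z: "z \<in> V" "num z < Suc b" for z
    proof (cases "num z = b")
      case b: True
      then obtain s where "s \<in> S" "(s, z) \<in> near E 2"
        using False z(1) by blast
      then show ?thesis
        using S(1) b by fastforce
    qed (use S(3) z in auto)
    moreover have "S \<subseteq> {x \<in> V. num x < Suc b}"
      using S(1) by auto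
    ultimately show ?thesis
      using S(2) by blast
  qed
qed auto

section \<open>The quotient graph\<close>

text \<open>Small numbers mean high levels. \<open>c z\<close> is the first member of
  \<open>S\<close> near \<open>z\<close>: \<open>c_num\<close> ensures that the level does not drop
  from \<open>z\<close> to \<open>c z\<close>, and \<open>c_min\<close> tells apart vertices with
  different centres.\<close>

locale net = tower V E P R n
  for V :: "'a set" and E P R n +
  fixes num :: "'a \<Rightarrow> nat" and S :: "'a set" and c :: "'a \<Rightarrow> 'a"
  assumes num_inj: "inj_on num V"
    and num_level: "\<And>x y. x \<in> V \<Longrightarrow> y \<in> V \<Longrightarrow> level y < level x \<Longrightarrow> num x < num y"
    and S_sub: "S \<subseteq> V"
    and S_sep: "\<And>s s'. s \<in> S \<Longrightarrow> s' \<in> S \<Longrightarrow> (s, s') \<in> near E 2 \<Longrightarrow> s = s'"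
    and c_S: "\<And>z. z \<in> V \<Longrightarrow> c z \<in> S"
    and c_near: "\<And>z. z \<in> V \<Longrightarrow> (c z, z) \<in> near E 2"
    and c_num: "\<And>z. z \<in> V \<Longrightarrow> num (c z) \<le> num z"
    and c_min: "\<And>z s. z \<in> V \<Longrightarrow> s \<in> S \<Longrightarrow> (s, z) \<in> near E 2 \<Longrightarrow> num (c z) \<le> num s"
begin

lemma level_antimono: "x \<in> V \<Longrightarrow> y \<in> V \<Longrightarrow> num x \<le> num y \<Longrightarrow> level y \<le> level x"
  using num_level[of y x] by linarith

lemma c_level: "z \<in> V \<Longrightarrow> level z \<le> level (c z)"
  using level_antimono[OF _ _ c_num] c_S S_sub by blast

lemma c_self: "s \<in> S \<Longrightarrow> c s = s"
  using S_sep[OF c_S _ c_near] S_sub by blast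

lemma num_inj_S: "inj_on num S"
  using num_inj S_sub by (rule inj_on_subset)

text \<open>Naming centres by their numbers puts the quotient on \<open>nat\<close>, where the usual
  order lists them by decreasing level.\<close>

definition W :: "nat set" where "W = num ` S"

definition F :: "nat set set" where
  "F = {{num (c z), num (c z')} | z z'. {z, z'} \<in> E \<and> c z \<noteq> c z'}"

lemma F_E:
  assumes "{a, b} \<in> F"
  obtains z z' where "{z, z'} \<in> E" "a = num (c z)" "b = num (c z')" "c z \<noteq> c z'"
proof -
  obtain z z' where z: "{z, z'} \<in> E" "c z \<noteq> c z'" "{a, b} = {num (c z), num (c z')}"
    using assms unfolding F_def by blast
  then consider "a = num (c z)" "b = num (c z')" | "a = num (c z')" "b = num (c z)"
    by (auto simp: doubleton_eq_iff)
  then show ?thesis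
    using that[of z z'] that[of z' z] z by cases (auto simp: insert_commute)
qed

lemma fin_graph_W: "fin_graph W F"
proof -
  have "num (c z) \<noteq> num (c z')" if "{z, z'} \<in> E" "c z \<noteq> c z'" for z z'
    using that inj_onD[OF num_inj_S] c_S E_carrier by blast
  then have "F \<subseteq> pairs W"
    using c_S E_carrier unfolding F_def W_def pairs_def by blast
  then show ?thesis
    using finite_V S_sub by (auto simp: fin_graph_def W_def intro: finite_subset)
qed

lemma F_pairs: "F \<subseteq> pairs W"
  using fin_graph_W by (simp add: fin_graph_def)

definition centre :: "nat \<Rightarrow> 'a" where "centre = inv_into S num"

lemma centre_num [simp]: "s \<in> S \<Longrightarrow> centre (num s) = s"
  unfolding centre_def using num_inj_S by (rule inv_into_f_f)

text \<open>The length is 2 + 1 + 2: from a centre to \<open>z\<close>, across the edge, and on to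
  the other centre.\<close>

lemma F_imp_near:
  assumes "{a, b} \<in> F"
  shows "(centre a, centre b) \<in> near E 5"
proof -
  obtain z z' where z: "{z, z'} \<in> E" "a = num (c z)" "b = num (c z')" "c z \<noteq> c z'"
    using assms by (rule F_E)
  have V: "z \<in> V" "z' \<in> V"
    using E_carrier[OF z(1)] by auto
  have "(c z, z) \<in> near E 2" "(z, z') \<in> near E (Suc 0)" "(z', c z') \<in> near E 2"
    using c_near[OF V(1)] near_sym[OF c_near[OF V(2)]] near_edge[OF z(1)] by auto
  from near_trans[OF near_trans[OF this(1,2)] this(3)]
  show ?thesis
    using z V c_S by simp
qed

lemma E_imp_near:
  assumes "{x, y} \<in> E"
  shows "(num (c x), num (c y)) \<in> near F 1"
  using assms near_edge[of _ _ F] unfolding F_def by (cases "c x = c y") auto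

lemma gdist_quotient_le:
  assumes "x \<in> V" "y \<in> V"
  shows "gdist W F (num (c x)) (num (c y)) \<le> gdist V E x y"
proof (cases "gdist V E x y")
  case (enat d)
  then have "(x, y) \<in> near E d"
    using gdist_le_iff_near[OF E_pairs assms(1), of y d] by simp
  then have "(num (c x), num (c y)) \<in> near F (1 * d)"
    using near_map[of x y E d "\<lambda>x. num (c x)" F 1] E_imp_near by blast
  then show ?thesis
    using gdist_le_iff_near[OF F_pairs] enat c_S assms by (simp add: W_def)
qed simp

lemma gdist_le_quotient:
  assumes "x \<in> V" "y \<in> V" "gdist W F (num (c x)) (num (c y)) \<le> enat d"
  shows "gdist V E x y \<le> enat (5 * d + 4)"
proof -
  have "(num (c x), num (c y)) \<in> near F d"
    using gdist_le_iff_near[OF F_pairs] assms c_S by (simp add: W_def)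
  from near_map[where f = centre, OF this F_imp_near] have "(c x, c y) \<in> near E (5 * d)"
    using assms c_S by simp
  from near_trans[OF near_trans[OF near_sym[OF c_near[OF assms(1)]] this] c_near[OF assms(2)]]
  have "(x, y) \<in> near E (5 * d + 4)"
    by (rule near_le) simp
  then show ?thesis
    using gdist_le_iff_near[OF E_pairs assms(1)] by blast
qed

text \<open>Distances \<open>g\<close> in the graph and \<open>h\<close> in the quotient satisfy
  \<open>h \<le> g\<close> and \<open>g \<le> 5 * h + 4\<close>, so 13 and 12 leave room.\<close>

lemma quasi_isometry_quotient: "quasi_isometry 13 12 V E W F (\<lambda>x. num (c x))"
  unfolding quasi_isometry_def
proof (intro conjI ballI)
  show "(\<lambda>x. num (c x)) ` V \<subseteq> W"
    using c_S by (auto simp: W_def)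
next
  fix x y assume xy: "x \<in> V" "y \<in> V"
  let ?g = "gdist V E x y" and ?h = "gdist W F (num (c x)) (num (c y))"
  show "ereal (1 / 13) * ereal_of_enat ?g - ereal 12 \<le> ereal_of_enat ?h"
  proof (cases ?h)
    case (enat d)
    then have le: "?g \<le> enat (5 * d + 4)"
      using gdist_le_quotient[OF xy] by simp
    then obtain e where e: "?g = enat e"
      by (cases ?g) auto
    then have "e \<le> 5 * d + 4"
      using le by simp
    then have "real e \<le> 5 * real d + 4"
      by linarith
    then show ?thesis
      using enat e by simp
  qed simp
  show "ereal_of_enat ?h \<le> ereal 13 * ereal_of_enat ?g + ereal 12"
  proof (cases ?g)
    case (enat d)
    then have le: "?h \<le> enat d"
      using gdist_quotient_le[OF xy] by simp
    then obtain e where "?h = enat e"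
      by (cases ?h) auto
    then show ?thesis
      using enat le by simp
  qed simp
next
  fix a assume a: "a \<in> W"
  then obtain s where s: "s \<in> S" "a = num s"
    by (auto simp: W_def)
  have "gdist W F a a \<le> enat 0"
    using gdist_le_iff_near[OF F_pairs a, of a 0] by simp
  then have "gdist W F a (num (c s)) = 0"
    using s c_self by (simp flip: zero_enat_def)
  then show "\<exists>x\<in>V. ereal_of_enat (gdist W F a (num (c x))) \<le> ereal 12"
    using s S_sub by (intro bexI[of _ s]) auto
qed

section \<open>Strong reachability\<close>

text \<open>By \<open>c_level\<close>, \<open>z\<close> is inactive along with its centre: 6 steps
  lead from the centre to \<open>z\<close> and 3 across the edge. The far centre may still be
  active, so the walk stops short of it.\<close>

lemma near_of_F_edge:
  assumes "{a, b} \<in> F" "level (centre a) \<le> t" "t \<le> n"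
  obtains z where "z \<in> V" "num (c z) = b" "(centre a, z) \<in> near (R t) 9"
proof -
  obtain z z' where z: "{z, z'} \<in> E" "a = num (c z)" "b = num (c z')" "c z \<noteq> c z'"
    using assms(1) by (rule F_E)
  have V: "z \<in> V" "z' \<in> V"
    using E_carrier[OF z(1)] by auto
  have a: "centre a = c z"
    using z V c_S by simp
  have lz: "level z \<le> t"
    using c_level[OF V(1)] assms(2) a by simp
  have "(c z, z) \<in> near (R t) 6"
    using near2_above_level[OF _ lz assms(3) c_near[OF V(1)]] assms(2) a by simp
  from near_trans[OF this near_above_level[OF lz assms(3) z(1)]]
  show ?thesis
    using that[of z'] V z a by simp
qed

text \<open>Now the far centre is inactive too and 6 further steps reach it, so an edge costs 9 +
  6.\<close>

lemma near_of_F_walk: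
  assumes "xs \<noteq> []" "successively (\<lambda>a b. {a, b} \<in> F) xs" "t \<le> n"
    and "\<forall>a\<in>set xs. level (centre a) \<le> t"
  shows "(centre (hd xs), centre (last xs)) \<in> near (R t) (15 * (length xs - 1))"
  using assms(1,2,4)
proof (induction xs rule: rev_nonempty_induct)
  case (snoc b xs)
  then have IH: "(centre (hd xs), centre (last xs)) \<in> near (R t) (15 * (length xs - 1))"
    and F: "{last xs, b} \<in> F" and la: "level (centre (last xs)) \<le> t"
    by (auto simp: successively_append_iff)
  obtain z where z: "z \<in> V" "num (c z) = b" "(centre (last xs), z) \<in> near (R t) 9"
    using near_of_F_edge[OF F la assms(3)] by blast
  have b: "centre b = c z"
    using z c_S by auto
  have lb: "level (c z) \<le> t"
    using snoc.prems(2) b by simp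
  have "(z, c z) \<in> near (R t) 6"
    using near_sym[OF near2_above_level[OF lb _ assms(3) c_near[OF z(1)]]] c_level[OF z(1)] lb
    by linarith
  from near_trans[OF near_trans[OF IH z(3)] this]
  have "(centre (hd xs), centre b) \<in> near (R t) (15 * (length xs - 1) + 9 + 6)"
    using b by simp
  also have "15 * (length xs - 1) + 9 + 6 = 15 * (length (xs @ [b]) - 1)"
    using snoc.hyps by (cases xs) auto
  finally show ?case
    using snoc.hyps by simp
qed simp

definition L :: "nat rel" where "L = {(a, b). a \<in> W \<and> b \<in> W \<and> a \<le> b}"

lemma linear_order_L: "linear_order_on W L"
  unfolding linear_order_on_def partial_order_on_def preorder_on_def L_def
  by (auto simp: refl_on_def trans_def antisym_def total_on_def)

text \<open>All vertices of the path but \<open>u\<close> have level at most that of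
  \<open>v\<close>. The last edge therefore costs 9 and ends at \<open>z\<close>, for a total of at
  most \<open>15 * (r - 1) + 9\<close>.\<close>

lemma strongly_reachable_cases:
  assumes "strongly_reachable W F L r (num v) (num u)" "v \<in> S" "u \<in> S"
  shows "u = v \<or> (1 \<le> r \<and> (\<exists>z\<in>V. c z = u \<and> (v, z) \<in> near (R (level v)) (15 * r - 6)))"
proof (cases "u = v")
  case False
  obtain xs where xs: "is_path W F xs (num v) (num u)" "path_length xs \<le> r"
      "\<forall>w\<in>set (butlast (tl xs)). (num v, w) \<in> L \<and> w \<noteq> num v"
    using assms(1) by (auto simp: strongly_reachable_def)
  have ne: "num v \<noteq> num u"
    using False assms inj_onD[OF num_inj_S] by blast
  then obtain ys where ys: "xs = num v # ys" "ys \<noteq> []"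
    using xs(1) by (cases xs) (auto simp: is_path_def split: if_splits)
  define zs where "zs = num v # butlast ys"
  have xs_eq: "xs = zs @ [num u]"
    using xs(1) ys append_butlast_last_id[OF ys(2)] by (simp add: is_path_def zs_def)
  have succ: "successively (\<lambda>a b. {a, b} \<in> F) zs" "{last zs, num u} \<in> F"
  proof -
    have "successively (\<lambda>a b. {a, b} \<in> F) (zs @ [num u])" "zs \<noteq> []"
      using xs(1) unfolding is_path_def xs_eq by (auto simp: zs_def)
    then show "successively (\<lambda>a b. {a, b} \<in> F) zs" "{last zs, num u} \<in> F"
      unfolding successively_append_iff by auto
  qed
  have lev: "\<forall>a\<in>set zs. level (centre a) \<le> level v"
  proof
    fix a assume "a \<in> set zs"
    then have "a \<in> W" "num v \<le> a"
      using xs(3) ys(1) assms(2) by (auto simp: zs_def L_def W_def)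
    then obtain s where "s \<in> S" "a = num s" "num v \<le> num s"
      by (auto simp: W_def)
    then show "level (centre a) \<le> level v"
      using level_antimono[of v s] assms(2) S_sub by auto
  qed
  have last_lev: "level (centre (last zs)) \<le> level v"
    using lev last_in_set[of zs] by (simp add: zs_def)
  have len: "1 \<le> r" "15 * (length zs - 1) + 9 \<le> 15 * r - 6"
    using xs(2) unfolding xs_eq by (auto simp: path_length_def zs_def)
  have "(v, centre (last zs)) \<in> near (R (level v)) (15 * (length zs - 1))"
    using near_of_F_walk[OF _ succ(1) level_le lev] assms(2) by (simp add: zs_def)
  moreover obtain z where z: "z \<in> V" "num (c z) = num u"
      "(centre (last zs), z) \<in> near (R (level v)) 9"
    using near_of_F_edge[OF succ(2) last_lev level_le] by blast
  ultimately have "(v, z) \<in> near (R (level v)) (15 * r - 6)"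
    using near_le[OF near_trans[of v "centre (last zs)"] len(2)] by simp
  moreover have "c z = u"
    using z(1,2) inj_onD[OF num_inj_S] c_S assms(3) by blast
  ultimately show ?thesis
    using z(1) len(1) by blast
qed simp

text \<open>Among the vertices \<open>u \<in> U\<close> listed by \<open>num\<close>, the neighbour \<open>y u\<close> of \<open>z u\<close> is not
  adjacent to \<open>z u'\<close> for any later \<open>u'\<close>, since otherwise \<open>c\<close> would have sent \<open>z u'\<close> to
  \<open>u\<close>. Hence the traces of the \<open>z u\<close> on the set of all \<open>y u\<close> but the last are distinct,
  and it remains to see that these \<open>y u\<close> lie in distinct parts that meet the ball.\<close>
lemma card_centres_of_part_le:
  assumes t: "t < n" and v: "v \<in> V" and X: "X \<in> P t" and U: "U \<subseteq> S"
    and lev: "\<And>u. u \<in> U \<Longrightarrow> t < level u"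
    and zX: "\<And>u. u \<in> U \<Longrightarrow> z u \<in> X"
    and cz: "\<And>u. u \<in> U \<Longrightarrow> c (z u) = u"
    and z_ball: "\<And>u. u \<in> U \<Longrightarrow> (v, z u) \<in> near (R (Suc t)) \<rho>"
    and z_alt: "\<And>u. u \<in> U \<Longrightarrow> z u \<noteq> u \<Longrightarrow> 6 \<le> \<rho> \<and>
        (v, z u) \<in> near (R (Suc t)) (\<rho> - 6) \<and> (v, u) \<notin> near (R (Suc t)) \<rho>"
    and k: "card (parts_meeting (gball V (R (Suc t)) (Suc \<rho>) v) (P t)) \<le> k"
  shows "card U \<le> nbh_complexity V E k"
proof (cases "U = {}")
  case False
  have fin: "finite U"
    using U S_sub finite_V by (meson finite_subset)
  have XV: "X \<subseteq> V"
    using partition[OF t] X by (auto simp: partition_on_def)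
  have zV: "z u \<in> V" if "u \<in> U" for u
    using zX[OF that] XV by blast
  \<comment> \<open>If \<open>z u = u\<close>, then \<open>y\<close> witnesses that \<open>u\<close>
    is active at time \<open>t\<close>; otherwise it comes from the walk of length at most 2 between
    \<open>z u\<close> and \<open>u\<close>, and may be \<open>u\<close> itself.\<close>
  have "\<exists>y. {z u, y} \<in> E \<and> (y = u \<or> {y, u} \<in> E) \<and> (z u = u \<longrightarrow> (u, y) \<notin> near (R t) 3)"
    if u: "u \<in> U" for u
  proof (cases "z u = u")
    case True
    obtain y where "{u, y} \<in> E" "(u, y) \<notin> near (R t) 3"
      using active_below_level[OF lev[OF u]] by (auto simp: active_def)
    then show ?thesis
      using True by (auto simp: insert_commute)
  next
    case False
    obtain y where "u = y \<or> {u, y} \<in> E" "y = z u \<or> {y, z u} \<in> E"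
      using c_near[OF zV[OF u]] cz[OF u] by (metis near_2E)
    then show ?thesis
      using False by (metis insert_commute)
  qed
  then obtain y where y:
    "\<And>u. u \<in> U \<Longrightarrow> {z u, y u} \<in> E"
    "\<And>u. u \<in> U \<Longrightarrow> y u = u \<or> {y u, u} \<in> E"
    "\<And>u. u \<in> U \<Longrightarrow> z u = u \<Longrightarrow> (u, y u) \<notin> near (R t) 3"
    by metis
  have yV: "y u \<in> V" if "u \<in> U" for u
    using E_carrier[OF y(1)[OF that]] by blast
  have zy: "z u' \<noteq> y u \<and> {z u', y u} \<notin> E" if "u \<in> U" "u' \<in> U" "num u < num u'" for u u'
  proof (rule ccontr)
    assume "\<not> (z u' \<noteq> y u \<and> {z u', y u} \<notin> E)"
    then have "(z u', u) \<in> near E 2"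
      using y(2)[OF that(1)] near_edge_le[of "y u" u E 2] near_2I[of "z u'" "y u" E u]
      by auto
    then have "num (c (z u')) \<le> num u"
      using c_min[OF zV[OF that(2)] _ near_sym] that(1) U by blast
    then show False
      using cz that by simp
  qed
  have uy: "u' \<noteq> y u \<and> {u', y u} \<notin> E" if "u \<in> U" "u' \<in> U" "u \<noteq> u'" for u u'
  proof (rule ccontr)
    assume "\<not> (u' \<noteq> y u \<and> {u', y u} \<notin> E)"
    then have "(u', u) \<in> near E 2"
      using y(2)[OF that(1)] near_edge_le[of "y u" u E 2] near_2I[of u' "y u" E u]
      by auto
    then show False
      using S_sep that U by blast
  qed
  have full: "{x, w} \<in> R t" if "{x0, w0} \<in> E" "{x0, w0} \<notin> R t" "X' \<in> P t" "Y \<in> P t" "x0 \<in> X'"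
    "w0 \<in> Y" "x \<in> X'" "w \<in> Y" "x \<noteq> w \<and> {x, w} \<notin> E" for x0 w0 x w X' Y
    using in_R_if_full[OF t that(3,4,5,6,1,2,7,8)] that(9) by blast
  have near_R: "(x, w) \<in> near (R (Suc t)) d" if "(x, w) \<in> near (R t) d" for x w d
    using near_mono[OF R_step[OF t]] that by blast
  have ext: "(v, w) \<in> near (R (Suc t)) (Suc d)"
    if "(v, x) \<in> near (R (Suc t)) d" "{x, w} \<in> R t \<or> {w, x} \<in> R t" for x w d
    using near_trans[OF that(1) near_R[OF near_edge, of x w]] that(2)
    by (auto simp: insert_commute)
  have "finite (num ` U)" "num ` U \<noteq> {}"
    using fin False by auto
  \<comment> \<open>Every member of \<open>U\<close> other than \<open>q\<close> has a later one,
    namely \<open>q\<close>, to compare with.\<close>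
  then obtain q where q: "q \<in> U" "num q = Max (num ` U)"
    by (metis Max_in imageE)
  have q_less: "num u < num q" if "u \<in> U - {q}" for u
  proof -
    have "num u \<le> num q"
      using q that fin by simp
    moreover have "num u \<noteq> num q"
      using inj_onD[OF num_inj_S, of u q] that q(1) U by blast
    ultimately show ?thesis
      by simp
  qed
  \<comment> \<open>Both pairs join \<open>X\<close> to the part of \<open>y u\<close>, one as an
    edge and one as a nonedge, so homogeneity puts one of them into \<open>R t\<close>.\<close>
  have zy_dist: "{z u, y u} \<in> R t \<or> {z u', y u} \<in> R t"
    if u: "u \<in> U" "u' \<in> U" "num u < num u'" for u u'
  proof -
    obtain Y where Y: "Y \<in> P t" "y u \<in> Y"
      using partition[OF t] yV[OF u(1)] by (auto simp: partition_on_def)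
    show ?thesis
      using full[OF y(1) _ X Y(1) zX Y(2) zX Y(2) zy] u by blast
  qed
  have y_ball: "(v, y u) \<in> near (R (Suc t)) (Suc \<rho>)" if "u \<in> U - {q}" for u
    using zy_dist[of u q] q_less[OF that] that q(1) z_ball ext by blast
  have parts_distinct: False
    if i: "i \<in> U - {q}" and j: "j \<in> U - {q}" and ij: "num i < num j"
      and Y: "Y \<in> P t" "y i \<in> Y" "y j \<in> Y" for i j Y
  proof -
    have iU: "i \<in> U" and jU: "j \<in> U"
      using i j by auto
    \<comment> \<open>If the edge from \<open>z j\<close> to \<open>y j\<close> avoids
      \<open>R t\<close>, these nonedges lie in \<open>R t\<close> and form the walk
      \<open>z j\<close>, \<open>y i\<close>, \<open>z q\<close>, \<open>y j\<close>.\<close>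
    have XY: "{z q, y j} \<in> R t \<and> {z q, y i} \<in> R t \<and> {z j, y i} \<in> R t"
      if "{z j, y j} \<notin> R t"
      using full[OF y(1)[OF jU] that X Y(1) zX[OF jU] Y(3)] zX q(1) jU iU Y
        zy[OF jU q(1) q_less[OF j]] zy[OF iU q(1) q_less[OF i]] zy[OF iU jU ij] by blast
    have walk: "(z j, y j) \<in> near (R t) 3"
    proof (cases "{z j, y j} \<in> R t")
      case True
      then show ?thesis
        by (rule near_edge_le) simp
    next
      case False
      then have "(z j, y i) \<in> near (R t) (Suc 0)" "(y i, z q) \<in> near (R t) (Suc 0)"
          "(z q, y j) \<in> near (R t) (Suc 0)"
        using XY near_edge[of "z j" "y i" "R t"] near_sym[OF near_edge, of "z q" "y i" "R t"]
          near_edge[of "z q" "y j" "R t"] by blast+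
      from near_trans[OF near_trans[OF this(1,2)] this(3)] show ?thesis
        by (simp add: numeral_3_eq_3)
    qed
    \<comment> \<open>The witness for an active \<open>j\<close> lies beyond distance 3, so
      \<open>j\<close> is represented indirectly: \<open>v\<close> reaches \<open>z j\<close> with 6
      steps to spare, but not \<open>j\<close>.\<close>
    then have zj: "z j \<noteq> j"
      using y(3)[OF jU] by auto
    note alt = z_alt[OF jU zj]
    have "(v, y j) \<in> near (R (Suc t)) (\<rho> - 6 + 3)"
      using near_trans[OF _ near_R[OF walk]] alt by blast
    \<comment> \<open>Three steps lead to \<open>y j\<close>; three more to \<open>j\<close> would
      bring \<open>j\<close> within \<open>\<rho>\<close> of \<open>v\<close>.\<close>
    then have "(y j, j) \<notin> near (R t) 3"
      using near_trans[OF _ near_R, of v "y j" "\<rho> - 6 + 3" j 3] alt by auto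
    then have act: "{j, y j} \<in> E" "{j, y j} \<notin> R t"
      using y(2)[OF jU] near_edge_le[of "y j" j "R t" 3] by (auto simp: insert_commute)
    obtain X' where X': "X' \<in> P t" "j \<in> X'"
      using partition[OF t] U S_sub jU by (auto simp: partition_on_def)
    have "{j, y i} \<in> R t"
      using full[OF act X'(1) Y(1) X'(2) Y(3) X'(2) Y(2) uy] iU jU ij by blast
    \<comment> \<open>Either \<open>z j\<close> or \<open>z i\<close> is joined to
      \<open>y i\<close> in \<open>R t\<close>. In the latter case \<open>z i = i\<close> is again
      excluded, so both are within \<open>\<rho> - 6\<close> of \<open>v\<close>.\<close>
    moreover have "(v, y i) \<in> near (R (Suc t)) (Suc (\<rho> - 6))"
    proof (cases "{z j, y i} \<in> R t")
      case True
      then show ?thesis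
        using ext alt by blast
    next
      case False
      then have zi: "{z i, y i} \<in> R t"
        using zy_dist[OF iU jU ij] by blast
      then have "z i \<noteq> i"
        using y(3)[OF iU] near_edge_le[of i "y i" "R t" 3] by auto
      then show ?thesis
        using z_alt[OF iU] ext zi by blast
    qed
    ultimately have "(v, j) \<in> near (R (Suc t)) (Suc (Suc (\<rho> - 6)))"
      using ext by blast
    then have "(v, j) \<in> near (R (Suc t)) \<rho>"
      by (rule near_le) (use conjunct1[OF alt] in arith)
    then show False
      using alt by blast
  qed
  define pt where "pt x = (SOME Y. Y \<in> P t \<and> x \<in> Y)" for x
  have pt: "pt x \<in> P t \<and> x \<in> pt x" if "x \<in> V" for x
    unfolding pt_def by (rule someI_ex) (use partition[OF t] that in \<open>auto simp: partition_on_def\<close>)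
  have "inj_on (\<lambda>u. pt (y u)) (U - {q})"
  proof (rule inj_onI, rule ccontr)
    fix i j assume ij: "i \<in> U - {q}" "j \<in> U - {q}" "pt (y i) = pt (y j)" "i \<noteq> j"
    have ne: "num i \<noteq> num j"
      using ij inj_onD[OF num_inj_S] U by blast
    have "pt (y i) \<in> P t" "y i \<in> pt (y i)" "y j \<in> pt (y i)"
      using ij pt[of "y i"] pt[of "y j"] yV by auto
    then show False
      using parts_distinct[OF ij(1,2)] parts_distinct[OF ij(2,1)] ne by (meson linorder_neqE_nat)
  qed
  moreover have "(\<lambda>u. pt (y u)) ` (U - {q})
      \<subseteq> parts_meeting (gball V (R (Suc t)) (Suc \<rho>) v) (P t)"
    using pt yV y_ball mem_gball_iff[OF R_pairs v] t
    by (fastforce simp: parts_meeting_def)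
  moreover have "finite (parts_meeting (gball V (R (Suc t)) (Suc \<rho>) v) (P t))"
    using finite_elements[OF finite_V partition[OF t]]
    by (auto simp: parts_meeting_def)
  ultimately have "card (U - {q}) \<le> k"
    using k by (meson card_inj_on_le le_trans)
  then have "card (y ` (U - {q})) \<le> k"
    using card_image_le[of "U - {q}" y] fin by simp
  then have le: "card ((\<lambda>x. nbh V E x \<inter> y ` (U - {q})) ` V) \<le> nbh_complexity V E k"
    by (intro card_nbh_traces_le[OF finite_V]) (use yV in auto)
  \<comment> \<open>Since \<open>j\<close> comes after \<open>i\<close>, \<open>i\<close> is not
    \<open>q\<close>, and \<open>y i\<close> is in the trace set.\<close>
  have sep: "nbh V E (z i) \<inter> y ` (U - {q}) \<noteq> nbh V E (z j) \<inter> y ` (U - {q})"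
    if "i \<in> U" "j \<in> U" "num i < num j" for i j
  proof -
    have "num j \<le> num q"
      using q_less[of j] that(2) by (cases "j = q") auto
    then have "y i \<in> y ` (U - {q})"
      using that by auto
    moreover have "y i \<in> nbh V E (z i)" "y i \<notin> nbh V E (z j)"
      using y(1) yV zy that by (auto simp: nbh_def)
    ultimately show ?thesis
      by blast
  qed
  have "inj_on (\<lambda>u. nbh V E (z u) \<inter> y ` (U - {q})) U"
  proof (rule inj_onI, rule ccontr)
    fix i j assume ij: "i \<in> U" "j \<in> U" "i \<noteq> j"
      "nbh V E (z i) \<inter> y ` (U - {q}) = nbh V E (z j) \<inter> y ` (U - {q})"
    then have "num i \<noteq> num j"
      using inj_onD[OF num_inj_S] U by blast
    then show False
      using sep[of i j] sep[of j i] ij by (metis linorder_neqE_nat)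
  qed
  then have "card U \<le> card ((\<lambda>x. nbh V E x \<inter> y ` (U - {q})) ` V)"
    using zV finite_V by (intro card_inj_on_le) auto
  then show ?thesis
    using le by simp
qed simp

text \<open>Each \<open>u\<close> is represented by some \<open>z u\<close>, namely \<open>u\<close>
  itself if \<open>v\<close> reaches it within \<open>\<rho>\<close>; the representatives are
  counted part by part.\<close>

lemma card_centres_le:
  assumes t: "t < n" and v: "v \<in> V" and U: "U \<subseteq> S"
    and lev: "\<And>u. u \<in> U \<Longrightarrow> t < level u"
    and reach: "\<And>u. u \<in> U \<Longrightarrow> (v, u) \<in> near (R (Suc t)) \<rho> \<or>
        (6 \<le> \<rho> \<and> (\<exists>z\<in>V. c z = u \<and> (v, z) \<in> near (R (Suc t)) (\<rho> - 6)))"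
    and k: "card (parts_meeting (gball V (R (Suc t)) (Suc \<rho>) v) (P t)) \<le> k"
  shows "card U \<le> k * nbh_complexity V E k"
proof -
  let ?PM = "parts_meeting (gball V (R (Suc t)) (Suc \<rho>) v) (P t)"
  have "\<exists>z. z \<in> V \<and> c z = u \<and> (v, z) \<in> near (R (Suc t)) \<rho> \<and>
      (z \<noteq> u \<longrightarrow> 6 \<le> \<rho> \<and> (v, z) \<in> near (R (Suc t)) (\<rho> - 6) \<and> (v, u) \<notin> near (R (Suc t)) \<rho>)"
    if u: "u \<in> U" for u
  proof (cases "(v, u) \<in> near (R (Suc t)) \<rho>")
    case True
    then show ?thesis
      using c_self u U S_sub by (intro exI[of _ u]) auto
  next
    case False
    then obtain z where "6 \<le> \<rho>" "z \<in> V" "c z = u" "(v, z) \<in> near (R (Suc t)) (\<rho> - 6)"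
      using reach[OF u] by blast
    moreover from this(4) have "(v, z) \<in> near (R (Suc t)) \<rho>"
      by (rule near_le) simp
    ultimately show ?thesis
      using False by blast
  qed
  then obtain z where z: "\<And>u. u \<in> U \<Longrightarrow> z u \<in> V" "\<And>u. u \<in> U \<Longrightarrow> c (z u) = u"
    "\<And>u. u \<in> U \<Longrightarrow> (v, z u) \<in> near (R (Suc t)) \<rho>"
    "\<And>u. u \<in> U \<Longrightarrow> z u \<noteq> u \<Longrightarrow> 6 \<le> \<rho> \<and> (v, z u) \<in> near (R (Suc t)) (\<rho> - 6) \<and>
        (v, u) \<notin> near (R (Suc t)) \<rho>"
    by metis
  have fin: "finite ?PM"
    using finite_elements[OF finite_V partition[OF t]]
    by (auto simp: parts_meeting_def)
  have part_le: "card {u \<in> U. z u \<in> X} \<le> nbh_complexity V E k" if "X \<in> ?PM" for X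
    using that U lev z
    by (intro card_centres_of_part_le[OF t v _ _ _ _ _ _ _ k, where X = X and z = z])
       (auto simp: parts_meeting_def)
  have sub: "U \<subseteq> (\<Union>X\<in>?PM. {u \<in> U. z u \<in> X})"
  proof
    fix u assume u: "u \<in> U"
    obtain X where X: "X \<in> P t" "z u \<in> X"
      using partition[OF t] z(1)[OF u] by (auto simp: partition_on_def)
    have "(v, z u) \<in> near (R (Suc t)) (Suc \<rho>)"
      using z(3)[OF u] by (rule near_le) simp
    then have "z u \<in> gball V (R (Suc t)) (Suc \<rho>) v"
      using mem_gball_iff[OF R_pairs v] t by auto
    then show "u \<in> (\<Union>X\<in>?PM. {u \<in> U. z u \<in> X})"
      using X u by (auto simp: parts_meeting_def)
  qed
  have finU: "finite U"
    using U S_sub finite_V by (meson finite_subset)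
  have "card U \<le> card (\<Union>X\<in>?PM. {u \<in> U. z u \<in> X})"
    using sub fin finU by (intro card_mono) auto
  also have "\<dots> \<le> (\<Sum>X\<in>?PM. card {u \<in> U. z u \<in> X})"
    using fin by (rule card_UN_le)
  also have "\<dots> \<le> card ?PM * nbh_complexity V E k"
    using sum_mono[OF part_le] by simp
  also have "\<dots> \<le> k * nbh_complexity V E k"
    using k by simp
  finally show ?thesis .
qed

lemma card_strongly_reachable_le:
  assumes v: "v \<in> S" and pos: "1 \<le> k * nbh_complexity V E k"
    and k: "\<And>t v. t < n \<Longrightarrow> v \<in> V \<Longrightarrow>
      card (parts_meeting (gball V (R (Suc t)) (18 * r + 1) v) (P t)) \<le> k"
  shows "card {a \<in> W. strongly_reachable W F L r (num v) a} \<le> k * nbh_complexity V E k"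
proof -
  define U where "U = {u \<in> S. strongly_reachable W F L r (num v) (num u)}"
  have "{a \<in> W. strongly_reachable W F L r (num v) a} = num ` U"
    by (auto simp: W_def U_def)
  then have card_eq: "card {a \<in> W. strongly_reachable W F L r (num v) a} = card U"
    using num_inj_S by (simp add: card_image inj_on_subset U_def)
  have vV: "v \<in> V"
    using v S_sub by blast
  show ?thesis
  proof (cases "level v")
    case 0
    \<comment> \<open>Walks in the empty \<open>R 0\<close> do not move.\<close>
    have "U \<subseteq> {v}"
    proof
      fix u assume u: "u \<in> U"
      then have uS: "u \<in> S" and r: "strongly_reachable W F L r (num v) (num u)"
        by (auto simp: U_def)
      show "u \<in> {v}"
      proof (rule ccontr)
        assume "u \<notin> {v}"
        then obtain z where z: "z \<in> V" "c z = u" "(v, z) \<in> near (R 0) (15 * r - 6)"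
          using strongly_reachable_cases[OF r v uS] 0 by auto
        have "near {} d = Id" for d :: nat
          by (induction d) (auto simp: near_Suc)
        then have "v = z"
          using z(3) R_start by auto
        then show False
          using z(2) c_self[OF v] \<open>u \<notin> {v}\<close> by simp
      qed
    qed
    then have "card U \<le> 1"
      using card_mono[of "{v}" U] by simp
    then show ?thesis
      using card_eq pos by linarith
  next
    case (Suc t)
    have t: "t < n"
      using Suc level_le[of v] by simp
    have "card U \<le> k * nbh_complexity V E k"
    proof (rule card_centres_le[OF t vV])
      show "U \<subseteq> S"
        by (auto simp: U_def)
      \<comment> \<open>\<open>u\<close> precedes \<open>v\<close>, so its level is at least
        \<open>Suc t\<close>.\<close>
      show "t < level u" if "u \<in> U" for u
      proof -
        have "num u \<le> num v" "u \<in> V"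
          using that S_sub by (auto simp: U_def strongly_reachable_def L_def)
        then show ?thesis
          using level_antimono[OF _ vV] Suc by fastforce
      qed
      \<comment> \<open>The radius exceeds \<open>18 * r\<close> by the one step from a
        representative to its neighbour \<open>y\<close>.\<close>
      show "card (parts_meeting (gball V (R (Suc t)) (Suc (18 * r)) v) (P t)) \<le> k"
        using k[OF t vV] by simp
      show "(v, u) \<in> near (R (Suc t)) (18 * r) \<or>
          (6 \<le> 18 * r \<and> (\<exists>z\<in>V. c z = u \<and> (v, z) \<in> near (R (Suc t)) (18 * r - 6)))"
        if u: "u \<in> U" for u
      proof (cases "u = v")
        case False
        then obtain z where z: "1 \<le> r" "z \<in> V" "c z = u"
            "(v, z) \<in> near (R (Suc t)) (15 * r - 6)"
          using strongly_reachable_cases[OF _ v, of r u] u Suc by (auto simp: U_def)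
        have "(v, z) \<in> near (R (Suc t)) (18 * r - 6)"
          using z(4) by (rule near_le) simp
        then show ?thesis
          using z by auto
      qed simp
    qed
    then show ?thesis
      using card_eq by simp
  qed
qed

lemma scol_quotient_le:
  assumes pos: "1 \<le> k * nbh_complexity V E k"
    and k: "\<And>t v. t < n \<Longrightarrow> v \<in> V \<Longrightarrow>
      card (parts_meeting (gball V (R (Suc t)) (18 * r + 1) v) (P t)) \<le> k"
  shows "scol r W F \<le> k * nbh_complexity V E k"
proof -
  have "scol r W F \<le> (SUP a\<in>W. card {b \<in> W. strongly_reachable W F L r a b})"
    unfolding scol_def using linear_order_L by (intro Least_le) blast
  also have "\<dots> \<le> k * nbh_complexity V E k"
  proof (cases "W = {}")
    case False
    then show ?thesis
      using card_strongly_reachable_le[OF _ pos k]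
      by (intro cSUP_least) (auto simp: W_def)
  qed simp
  finally show ?thesis .
qed

end

section \<open>Constructing the numbering and the net\<close>

context tower
begin

lemma exists_net: "\<exists>num S c. net V E P R n num S c"
proof -
  obtain idx where "bij_betw idx V {0..<card V}"
    using ex_bij_betw_finite_nat[OF finite_V] by blast
  then have idx: "inj_on idx V" "idx ` V = {0..<card V}"
    by (auto simp: bij_betw_def)
  \<comment> \<open>Decreasing level first, then \<open>idx\<close>, written in base
    \<open>card V\<close>.\<close>
  define num where "num x = (n - level x) * card V + idx x" for x
  have idx_less: "idx x < card V" if "x \<in> V" for x
    using idx(2) that by fastforce
  have num_level: "num x < num y" if "x \<in> V" "y \<in> V" "level y < level x" for x y
  proof -
    have "Suc (n - level x) \<le> n - level y"
      using that(3) level_le[of x] by simp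
    then have "Suc (n - level x) * card V \<le> (n - level y) * card V"
      by (rule mult_le_mono1)
    then show ?thesis
      using idx_less[OF that(1)] by (simp add: num_def)
  qed
  have num_inj: "inj_on num V"
  proof (rule inj_onI)
    fix x y assume xy: "x \<in> V" "y \<in> V" "num x = num y"
    then have "level x = level y"
      using num_level[of x y] num_level[of y x] by (metis less_irrefl linorder_neqE_nat)
    then show "x = y"
      using xy idx(1) by (auto simp: num_def dest: inj_onD)
  qed
  obtain b where b: "\<And>z. z \<in> V \<Longrightarrow> num z < b"
    using finite_V by (metis finite_imageI finite_nat_set_iff_bounded imageI)
  obtain S where S': "S \<subseteq> {x \<in> V. num x < b}"
    and S_sep: "\<forall>s\<in>S. \<forall>s'\<in>S. (s, s') \<in> near E 2 \<longrightarrow> s = s'"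
    and S_dom: "\<forall>z\<in>V. num z < b \<longrightarrow> (\<exists>s\<in>S. (s, z) \<in> near E 2 \<and> num s \<le> num z)"
    using exists_greedy_net[OF num_inj, of b E] by (elim exE conjE)
  have S: "S \<subseteq> V" "\<And>z. z \<in> V \<Longrightarrow> \<exists>s\<in>S. (s, z) \<in> near E 2 \<and> num s \<le> num z"
    using S' S_dom b by auto
  define c where "c z = arg_min num (\<lambda>s. s \<in> S \<and> (s, z) \<in> near E 2)" for z
  have c: "c z \<in> S \<and> (c z, z) \<in> near E 2" if "z \<in> V" for z
  proof -
    obtain s where "s \<in> S \<and> (s, z) \<in> near E 2"
      using S(2)[OF \<open>z \<in> V\<close>] by blast
    then show ?thesis
      unfolding c_def by (rule arg_min_natI)
  qed
  have c_min: "num (c z) \<le> num s" if "s \<in> S" "(s, z) \<in> near E 2" for z s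
    unfolding c_def by (rule arg_min_nat_le) (use that in simp)
  have "net V E P R n num S c"
  proof unfold_locales
    show "num (c z) \<le> num z" if "z \<in> V" for z
      using S(2)[OF that] c_min le_trans by blast
  qed (use num_inj num_level S(1) S_sep c c_min in auto)
  then show ?thesis
    by blast
qed

end

section \<open>Merge sequences\<close>

lemma singletons_homogeneous: "homogeneous_mod E ((\<lambda>v. {v}) ` V) R"
  by (auto simp: homogeneous_mod_def)

lemma partition_on_singletons: "partition_on V ((\<lambda>v. {v}) ` V)"
  by (auto simp: partition_on_def disjoint_def)

lemma partition_on_whole: "V \<noteq> {} \<Longrightarrow> partition_on V {V}"
  by (auto simp: partition_on_def disjoint_def)

text \<open>Guarantees that the \<open>LEAST\<close> in \<open>merge_width\<close> is attained.
  Taking all pairs as \<open>R\<close> makes homogeneity vacuous.\<close>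

lemma exists_merge_sequence:
  assumes "V \<noteq> {}"
  shows "\<exists>m P R. 2 \<le> m \<and> merge_sequence V E m P R"
proof -
  let ?P = "\<lambda>t::nat. if t = 1 then (\<lambda>v. {v}) ` V else {V}"
  let ?R = "\<lambda>t::nat. pairs V"
  have "homogeneous_mod E {V} (pairs V)"
    by (auto simp: homogeneous_mod_def pairs_doubleton)
  then have "merge_sequence V E 2 ?P ?R"
    using singletons_homogeneous partition_on_singletons partition_on_whole[OF assms]
    by (auto simp: merge_sequence_def refines_def)
  then show ?thesis
    by (metis order_refl)
qed

lemma card_parts_le_seq_width:
  assumes "finite V" "t \<in> {1..<m}" "v \<in> V"
  shows "card (parts_meeting (gball V (R (Suc t)) r v) (P t)) \<le> seq_width V r m P R"
proof -
  have "card (parts_meeting (gball V (R (Suc t)) r v) (P t))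
      \<le> (SUP v\<in>V. card (parts_meeting (gball V (R (Suc t)) r v) (P t)))"
    using assms by (intro cSUP_upper) auto
  also have "\<dots> \<le> seq_width V r m P R"
    unfolding seq_width_def using assms
    by (intro cSUP_upper[where f = "\<lambda>t. SUP v\<in>V. card (parts_meeting (gball V (R (Suc t)) r v) (P t))"]) auto
  finally show ?thesis .
qed

text \<open>The sequence is extended at both ends, by \<open>R = {}\<close> with singletons and by all
  pairs, so that every vertex of positive degree is active at first and none at last.\<close>
lemma exists_tower:
  assumes fg: "fin_graph V E" and ne: "V \<noteq> {}" and ms: "merge_sequence V E m P R" and m: "2 \<le> m"
    and k: "k = seq_width V r m P R"
  shows "\<exists>P' R' n. tower V E P' R' n \<and> 1 \<le> k \<and>
    (\<forall>t<n. \<forall>v\<in>V. card (parts_meeting (gball V (R' (Suc t)) r v) (P' t)) \<le> k)"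
proof -
  define P' where "P' t = (if t = 0 then P 1 else P t)" for t
  define R' where "R' t = (if t = 0 then {} else if t = Suc m then pairs V else R t)" for t
  have fin: "finite V" and E: "E \<subseteq> pairs V"
    using fg by (auto simp: fin_graph_def)
  have P1: "P 1 = (\<lambda>v. {v}) ` V" and Pm: "P m = {V}"
    using ms by (auto simp: merge_sequence_def)
  have at: "partition_on V (P t)" "R t \<subseteq> pairs V" "homogeneous_mod E (P t) (R t)"
    if "1 \<le> t" "t \<le> m" for t
    using ms that by (auto simp: merge_sequence_def)
  have step: "R t \<subseteq> R (Suc t)" if "1 \<le> t" "t < m" for t
    using ms that by (auto simp: merge_sequence_def)
  have tower: "tower V E P' R' (Suc m)"
  proof
    show "partition_on V (P' t)" if "t < Suc m" for t
      using at(1)[of t] at(1)[of 1] that m by (auto simp: P'_def Suc_le_eq)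
    show "homogeneous_mod E (P' t) (R' t)" if "t < Suc m" for t
      using at(3)[of t] that singletons_homogeneous[of E V] P1
      by (auto simp: P'_def R'_def Suc_le_eq)
    show "R' t \<subseteq> R' (Suc t)" if "t < Suc m" for t
      using at(2)[of t] step[of t] that m by (auto simp: R'_def Suc_le_eq)
    show "R' t \<subseteq> pairs V" if "t \<le> Suc m" for t
      using at(2)[of t] that by (auto simp: R'_def Suc_le_eq)
  qed (use fin E in \<open>auto simp: R'_def\<close>)
  obtain v0 where v0: "v0 \<in> V"
    using ne by blast
  have finP: "finite (parts_meeting B (P t))" if "1 \<le> t" "t \<le> m" for t B
    using finite_elements[OF fin at(1)[OF that]] by (auto simp: parts_meeting_def)
  have self: "v \<in> gball V (R 2) d v" if "v \<in> V" for v d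
    using mem_gball_iff[OF at(2) that, of 2] m by simp
  have k1: "1 \<le> k"
  proof -
    have "{v0} \<in> parts_meeting (gball V (R 2) r v0) (P 1)"
      using v0 self[OF v0] P1 by (auto simp: parts_meeting_def)
    then have "card (parts_meeting (gball V (R 2) r v0) (P 1)) \<noteq> 0"
      using finP[of 1] m by auto
    moreover have "card (parts_meeting (gball V (R 2) r v0) (P 1)) \<le> k"
      using card_parts_le_seq_width[OF fin _ v0, of 1 m R r P] m k by (simp add: numeral_2_eq_2)
    ultimately show ?thesis
      by linarith
  qed
  have bound: "card (parts_meeting (gball V (R' (Suc t)) r v) (P' t)) \<le> k"
    if t: "t < Suc m" and v: "v \<in> V" for t v
  proof -
    consider "t = 0" | "1 \<le> t" "t < m" | "t = m"
      using t by linarith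
    then show ?thesis
    proof cases
      case 1
      \<comment> \<open>The added time 0 pairs \<open>P 1\<close> with \<open>R 1\<close>, which is
        dominated by the pair \<open>P 1\<close>, \<open>R 2\<close> of the given sequence.\<close>
      have "R 1 \<subseteq> R 2"
        using step[of 1] m by (simp add: numeral_2_eq_2)
      then have "gball V (R 1) r v \<subseteq> gball V (R 2) r v"
        using mem_gball_iff[OF at(2) v, of 1] mem_gball_iff[OF at(2) v, of 2]
          subsetD[OF near_mono[of "R 1" "R 2"]] m by auto
      then have "parts_meeting (gball V (R 1) r v) (P 1) \<subseteq> parts_meeting (gball V (R 2) r v) (P 1)"
        by (auto simp: parts_meeting_def)
      then have "card (parts_meeting (gball V (R 1) r v) (P 1))
          \<le> card (parts_meeting (gball V (R 2) r v) (P 1))"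
        using finP[of 1] m by (intro card_mono) auto
      also have "\<dots> \<le> k"
        using card_parts_le_seq_width[OF fin _ v, of 1 m R r P] m k by (simp add: numeral_2_eq_2)
      finally show ?thesis
        using 1 m by (simp add: P'_def R'_def)
    next
      case 2
      then show ?thesis
        using card_parts_le_seq_width[OF fin _ v, of t m R r P] k by (simp add: P'_def R'_def)
    next
      case 3
      have "card (parts_meeting (gball V (R' (Suc t)) r v) {V}) \<le> card {V}"
        by (intro card_mono) (auto simp: parts_meeting_def)
      then show ?thesis
        using 3 m Pm k1 by (simp add: P'_def)
    qed
  qed
  show ?thesis
    using tower bound k1 by blast
qed

theorem theorem8p3:
  fixes r k :: nat and V :: "'a set" and E :: "'a set set"
  assumes "fin_graph V E"
    and "k = merge_width (18 * r + 1) V E"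
  shows "\<exists>(W :: nat set) F. fin_graph W F \<and> quasi_isometric 13 12 V E W F \<and>
           scol r W F \<le> k * nbh_complexity V E k"
proof (cases "V = {}")
  case True
  \<comment> \<open>The partition \<open>{V}\<close> is illegal for empty \<open>V\<close>, so
    \<open>k\<close> is unspecified and the bound must be met with 0.\<close>
  have "linear_order_on {} ({} :: nat rel)"
    by (simp add: linear_order_on_def partial_order_on_def preorder_on_def refl_on_def
        trans_def antisym_def total_on_def)
  then have "\<exists>L. linear_order_on {} (L :: nat rel)"
    by blast
  then have "scol r ({} :: nat set) {} \<le> 0"
    unfolding scol_def by (intro Least_le) auto
  then show ?thesis
    using True by (intro exI[of _ "{}"])
      (auto simp: fin_graph_def quasi_isometric_def quasi_isometry_def)
next
  case False
  have "\<exists>w m P R. 2 \<le> m \<and> merge_sequence V E m P R \<and> w = seq_width V (18 * r + 1) m P R"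
    using exists_merge_sequence[OF False] by blast
  then have "\<exists>m P R. 2 \<le> m \<and> merge_sequence V E m P R \<and> k = seq_width V (18 * r + 1) m P R"
    unfolding assms(2) merge_width_def by (rule LeastI_ex)
  then obtain P R n where tower: "tower V E P R n" and k1: "1 \<le> k"
    and k: "\<And>t v. t < n \<Longrightarrow> v \<in> V \<Longrightarrow>
      card (parts_meeting (gball V (R (Suc t)) (18 * r + 1) v) (P t)) \<le> k"
    using exists_tower[OF assms(1) False] by metis
  obtain num S c where "net V E P R n num S c"
    using tower.exists_net[OF tower] by blast
  then interpret net V E P R n num S c .
  \<comment> \<open>The empty set has exactly one trace, so the complexity is positive.\<close>
  have "card ((\<lambda>v. nbh V E v \<inter> {}) ` V) \<le> nbh_complexity V E k"
    by (intro card_nbh_traces_le[OF finite_V]) auto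
  then have "1 \<le> nbh_complexity V E k"
    using False by (simp add: image_constant_conv)
  then have "1 \<le> k * nbh_complexity V E k"
    using k1 by simp
  then show ?thesis
    using fin_graph_W quasi_isometry_quotient scol_quotient_le[OF _ k]
    unfolding quasi_isometric_def by blast
qed

end
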